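(* Let $d\ge 2$ and let $\nu_d$ be a probability measure on $(0,\infty)$, the radius distribution of the balls of an isometry-invariant random ball process in the $d$-dimensional space $\mathbb{M}_k^d$ of constant curvature $k$ (the same $\nu_d$ for all $k$). Let $\nu_{d-1}^{(k)}$ be the induced radius distribution of the sectional balls within a totally geodesic hypersurface $L$ of $\mathbb{M}_k^d$, as specified by the formulas in the context, and assume (as made precise there) that these are well defined for all $k$ in a neighbourhood of $0$. Then $$\nu_{d-1}^{(k)}\xrightarrow[k\to 0,\ k\neq 0]{w}\nu_{d-1}^{(0)},$$ i.e. $\nu_{d-1}^{(k)}$ converges weakly to the corresponding Euclidean section radius distribution $\nu_{d-1}^{(0)}$ as the curvature $k$ tends to $0$.
   Context: Conventions. $l_k:=\frac{\pi}{2\sqrt{k}}$ if $k>0$ and $l_k:=\infty$ if $k\le 0$; if $l_k=\infty$, $(r,l_k]$ means $(r,\infty)$. The symbol $\cos(\sqrt{k}\,h)$ means the usual cosine if $k>0$, $1$ if $k=0$, and $\cosh(\sqrt{-k}\,h)$ if $k<0$. For $0\le|h|\le t\le l_k$ (with $t<\infty$), $$\alpha_k(t,h):=\begin{cases}\frac{1}{\sqrt{-k}}\operatorname{arcosh}\!\left(\frac{\cosh(\sqrt{-k}\,t)}{\cosh(\sqrt{-k}\,h)}\right), & k<0,\\[2pt] \sqrt{t^2-h^2}, & k=0,\\[2pt] \frac{1}{\sqrt{k}}\arccos\!\left(\frac{\cos(\sqrt{k}\,t)}{\cos(\sqrt{k}\,h)}\right), & k>0.\end{cases}$$ Setting. $\mathbb{M}_k^d$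 is the sphere of radius $1/\sqrt{k}$ ($k>0$), $\mathbb{R}^d$ ($k=0$), or hyperbolic space of curvature $k$ ($k<0$). Balls are centred at the points of a point process with isometry-invariant law and finite positive intensity, with independent radii of law $\nu_d$ (for $k>0$ only radii in $(0,l_k]$ are taken into account). Intersecting the balls with $L$ gives a process of balls in $L$, and $\nu_{d-1}^{(k)}$ is the distribution of its radii. Formulas. Put $$m_k:=\int_{(0,l_k]}\int_{-R}^{R}\cos^{d-1}(\sqrt{k}\,h)\,\mathrm{d}h\,\nu_d(\mathrm{d}R),$$ the ratio of the intensity of the section process to that of the original process. Standing assumption: there is $\kappa>0$ such that $0<m_k<\infty$ for all $k\in(-\kappa,\kappa)$. For such $k$, $\nu_{d-1}^{(k)}$ is the probability measure on $(0,\infty)$, concentrated on $(0,l_k]$, determined by $$\nu_{d-1}^{(k)}((r,l_k])=\frac{1}{m_k}\int_{(r,l_k]}\int_{-\alpha_k(R,r)}^{\alpha_k(R,r)}\cos^{d-1}(\sqrt{k}\,h)\,\mathrm{d}h\,\nu_d(\mathrm{d}R),\qquad 0\le r<l_k.$$ In particular, for $k=0$, $m_0=2\int_0^\infty R\,\nu_d(\mathrm{d}R)$ and $\nu_{d-1}^{(0)}((r,\infty))=\frac{2}{m_0}\int_{(r,\infty)}\sqrt{R^2-r^2}\,\nu_d(\mathrm{d}R)$. *)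

theory Defs
  imports "HOL-Probability.Probability"
begin

section \<open>Trigonometry of the space of constant curvature \<open>k\<close>\<close>

definition max_radius :: "real \<Rightarrow> ereal" where
  "max_radius k = (if k > 0 then ereal (pi / (2 * sqrt k)) else \<infinity>)"

text \<open>The intended reading of \<open>cos (sqrt k * h)\<close> for a real \<open>k\<close> of any sign.\<close>

definition cos_curv :: "real \<Rightarrow> real \<Rightarrow> real" where
  "cos_curv k h =
     (if k > 0 then cos (sqrt k * h) else if k = 0 then 1 else cosh (sqrt (- k) * h))"

text \<open>
  Meaningful for \<open>\<bar>h\<bar> \<le> t \<le> max_radius k\<close>, except at \<open>\<bar>h\<bar> = t = max_radius k\<close> (for \<open>k > 0\<close>), where
  the quotient is \<open>0/0\<close>. Below it is only evaluated at \<open>0 \<le> h < t \<le> max_radius k\<close>.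
\<close>

definition alpha_curv :: "real \<Rightarrow> real \<Rightarrow> real \<Rightarrow> real" where
  "alpha_curv k t h =
     (if k < 0 then arcosh (cosh (sqrt (- k) * t) / cosh (sqrt (- k) * h)) / sqrt (- k)
      else if k = 0 then sqrt (t\<^sup>2 - h\<^sup>2)
      else arccos (cos (sqrt k * t) / cos (sqrt k * h)) / sqrt k)"

text \<open>The interval \<open>(r, l]\<close> of real numbers, to be read as \<open>(r, \<infinity>)\<close> if \<open>l = \<infinity>\<close>.\<close>

definition Ioc_ereal :: "real \<Rightarrow> ereal \<Rightarrow> real set" where
  "Ioc_ereal r l = {x. r < x \<and> ereal x \<le> l}"

section \<open>Radius distributions and their sections\<close>

text \<open>Probability measures on \<open>(0, \<infinity>)\<close>, as Borel measures on the real line carried by \<open>(0, \<infinity>)\<close>.\<close>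

definition radius_distribution :: "real measure \<Rightarrow> bool" where
  "radius_distribution N \<longleftrightarrow> real_distribution N \<and> emeasure N {0<..} = 1"

text \<open>
  The integrals take values in \<open>[0, \<infinity>]\<close>. The coercion \<open>ennreal\<close> truncates nothing: on the domain
  of integration \<open>\<bar>h\<bar> \<le> R \<le> max_radius k\<close>, so \<open>cos_curv k h \<ge> 0\<close>.
\<close>

definition intensity_ratio :: "nat \<Rightarrow> real measure \<Rightarrow> real \<Rightarrow> ennreal" where
  "intensity_ratio d \<nu> k =
     (\<integral>\<^sup>+R\<in>Ioc_ereal 0 (max_radius k).
        (\<integral>\<^sup>+h\<in>{- R..R}. ennreal (cos_curv k h ^ (d - 1)) \<partial>lborel) \<partial>\<nu>)"

definition is_section_radius_distribution ::
  "nat \<Rightarrow> real measure \<Rightarrow> real \<Rightarrow> real measure \<Rightarrow> bool" where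
  "is_section_radius_distribution d \<nu> k N \<longleftrightarrow>
     radius_distribution N \<and>
     emeasure N (Ioc_ereal 0 (max_radius k)) = 1 \<and>
     (\<forall>r. 0 \<le> r \<and> ereal r < max_radius k \<longrightarrow>
        emeasure N (Ioc_ereal r (max_radius k)) =
          (\<integral>\<^sup>+R\<in>Ioc_ereal r (max_radius k).
             (\<integral>\<^sup>+h\<in>{- alpha_curv k R r..alpha_curv k R r}.
                ennreal (cos_curv k h ^ (d - 1)) \<partial>lborel) \<partial>\<nu>)
          / intensity_ratio d \<nu> k)"

section \<open>Weak convergence along a filter\<close>

text \<open>
  The library's \<open>weak_conv_m\<close> covers sequences only. For probability measures it is the instance
  of the following notion at the filter \<open>sequentially\<close>; see the lemma below.
\<close>

definition weak_conv_along :: "'i filter \<Rightarrow> ('i \<Rightarrow> real measure) \<Rightarrow> real measure \<Rightarrow> bool" where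
  "weak_conv_along F M N \<longleftrightarrow>
     (\<forall>f :: real \<Rightarrow> real. continuous_on UNIV f \<longrightarrow> bounded (range f) \<longrightarrow>
        ((\<lambda>i. integral\<^sup>L (M i) f) \<longlongrightarrow> integral\<^sup>L N f) F)"

lemma weak_conv_along_sequentially_iff:
  assumes "\<And>n. real_distribution (M n)" and "real_distribution N"
  shows "weak_conv_along sequentially M N \<longleftrightarrow> weak_conv_m M N"
proof
  assume *: "weak_conv_along sequentially M N"
  show "weak_conv_m M N"
  proof (rule integral_bdd_continuous_conv_imp_weak_conv[OF assms])
    fix f :: "real \<Rightarrow> real"
    assume "\<And>x. isCont f x" and "\<And>x. \<bar>f x\<bar> \<le> 1"
    then show "(\<lambda>n. integral\<^sup>L (M n) f) \<longlonglongrightarrow> integral\<^sup>L N f"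
      using * unfolding weak_conv_along_def
      by (auto simp: continuous_on_eq_continuous_at bounded_iff)
  qed
next
  assume *: "weak_conv_m M N"
  show "weak_conv_along sequentially M N"
    unfolding weak_conv_along_def
  proof (intro allI impI)
    fix f :: "real \<Rightarrow> real"
    assume cont: "continuous_on UNIV f" and "bounded (range f)"
    then obtain B where "\<And>x. norm (f x) \<le> B"
      by (auto simp: bounded_iff)
    with cont show "(\<lambda>n. integral\<^sup>L (M n) f) \<longlonglongrightarrow> integral\<^sup>L N f"
      by (intro weak_conv_imp_integral_bdd_continuous_conv[OF assms *])
         (auto simp: continuous_on_eq_continuous_at)
  qed
qed

end

theory Submission
  imports Defs "HOL-Real_Asymp.Real_Asymp"
begin

text \<open>
  For \<open>0 \<le> r < R \<le> max_radius k\<close> and \<open>k \<noteq> 0\<close> the inequality \<open>\<bar>h\<bar> \<le> alpha_curv k R r\<close> says that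
  \<open>(cos_curv k h * cos_curv k r - cos_curv k R) / k \<ge> 0\<close> (and \<open>\<bar>h\<bar> \<le> R\<close>). This quotient converges
  to \<open>(R\<^sup>2 - r\<^sup>2 - h\<^sup>2) / 2\<close> as \<open>k \<rightarrow> 0\<close>, so the indicator of the domain of integration converges
  for almost every \<open>h\<close>. As \<open>cos_curv k h\<close> is bounded by \<open>cos_curv (- c) h\<close> for \<open>\<bar>k\<bar> < c\<close>, and the
  intensity ratio is finite at \<open>- c\<close>, dominated convergence gives the convergence of the tail
  integrals. The intensity ratio is the tail integral at \<open>r = 0\<close>, so the distribution functions
  converge pointwise.
\<close>

section \<open>The limit of the trigonometric functions as the curvature vanishes\<close>

lemma cos_curv_even: "cos_curv k \<bar>h\<bar> = cos_curv k h"
  by (auto simp: cos_curv_def abs_if)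

lemma max_radius_nonpos: "k \<le> 0 \<Longrightarrow> max_radius k = \<infinity>"
  by (simp add: max_radius_def)

lemma le_max_radius_pos_iff:
  "0 < k \<Longrightarrow> ereal x \<le> max_radius k \<longleftrightarrow> sqrt k * x \<le> pi / 2"
  by (simp add: max_radius_def field_simps)

text \<open>The trigonometric and the hyperbolic branch share the expansion
  \<open>1 - k * h\<^sup>2 / 2 + O(k\<^sup>2)\<close>, so the two one-sided limits agree.\<close>

lemma cos_curv_quotient_tendsto:
  "((\<lambda>k. (1 - cos_curv k h) / k) \<longlongrightarrow> h\<^sup>2 / 2) (at 0)"
proof -
  \<comment> \<open>Evenness in \<open>h\<close> and the trivial case \<open>h = 0\<close> leave
    positive \<open>h\<close>, a sign that \<open>real_asymp\<close> can use.\<close>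
  have *: "((\<lambda>k. (1 - cos_curv k h) / k) \<longlongrightarrow> h\<^sup>2 / 2) (at 0)" if "h > 0" for h
  proof (rule filterlim_split_at)
    have "((\<lambda>k. (1 - cos (sqrt k * h)) / k) \<longlongrightarrow> h\<^sup>2 / 2) (at_right 0)"
      using that by (real_asymp simp: power2_eq_square)
    moreover have "\<forall>\<^sub>F k in at_right 0. (1 - cos (sqrt k * h)) / k = (1 - cos_curv k h) / k"
      by (auto simp: eventually_at_filter cos_curv_def)
    ultimately show "((\<lambda>k. (1 - cos_curv k h) / k) \<longlongrightarrow> h\<^sup>2 / 2) (at_right 0)"
      by (rule Lim_transform_eventually)
    have "((\<lambda>k. (1 - cosh (sqrt (- k) * h)) / k) \<longlongrightarrow> h\<^sup>2 / 2) (at_left 0)"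
      using that by (real_asymp simp: power2_eq_square)
    moreover have "\<forall>\<^sub>F k in at_left 0. (1 - cosh (sqrt (- k) * h)) / k = (1 - cos_curv k h) / k"
      by (auto simp: eventually_at_filter cos_curv_def)
    ultimately show "((\<lambda>k. (1 - cos_curv k h) / k) \<longlongrightarrow> h\<^sup>2 / 2) (at_left 0)"
      by (rule Lim_transform_eventually)
  qed
  show ?thesis
  proof (cases "h = 0")
    case True
    then have "cos_curv k h = 1" for k by (simp add: cos_curv_def)
    with True show ?thesis by simp
  next
    case False
    then show ?thesis
      using *[of "\<bar>h\<bar>"] by (simp add: cos_curv_even)
  qed
qed

lemma cos_curv_tendsto: "((\<lambda>k. cos_curv k h) \<longlongrightarrow> 1) (at 0)"
proof -
  have "((\<lambda>k. 1 - (1 - cos_curv k h) / k * k) \<longlongrightarrow> 1 - h\<^sup>2 / 2 * 0) (at 0)"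
    by (intro tendsto_intros cos_curv_quotient_tendsto)
  moreover have "\<forall>\<^sub>F k in at 0. 1 - (1 - cos_curv k h) / k * k = cos_curv k h"
    by (auto simp: eventually_at_filter)
  ultimately show ?thesis
    by (auto intro: Lim_transform_eventually)
qed

text \<open>Cosine decreases and cosh increases on the nonnegative arguments in question; dividing
  by \<open>k\<close> gives both cases the same direction of inequality. The value at
  \<open>k = 0\<close> is the limit, so one sign condition covers all curvatures.\<close>

definition cos_excess :: "real \<Rightarrow> real \<Rightarrow> real \<Rightarrow> real \<Rightarrow> real" where
  "cos_excess k R r h =
     (if k = 0 then (R\<^sup>2 - r\<^sup>2 - h\<^sup>2) / 2
      else (cos_curv k h * cos_curv k r - cos_curv k R) / k)"

lemma cos_excess_tendsto: "((\<lambda>k. cos_excess k R r h) \<longlongrightarrow> cos_excess 0 R r h) (at 0)"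
proof -
  \<comment> \<open>The numerator of \<open>cos_excess\<close> is rewritten in terms of the
    differences \<open>1 - cos_curv k x\<close>, whose quotients by \<open>k\<close> have known
    limits.\<close>
  have "((\<lambda>k. (1 - cos_curv k R) / k - (1 - cos_curv k h) / k
            - cos_curv k h * ((1 - cos_curv k r) / k))
          \<longlongrightarrow> R\<^sup>2 / 2 - h\<^sup>2 / 2 - 1 * (r\<^sup>2 / 2)) (at 0)"
    by (intro tendsto_intros cos_curv_quotient_tendsto cos_curv_tendsto)
  moreover have "\<forall>\<^sub>F k in at 0. (1 - cos_curv k R) / k - (1 - cos_curv k h) / k
            - cos_curv k h * ((1 - cos_curv k r) / k) = cos_excess k R r h"
    by (auto simp: eventually_at_filter cos_excess_def field_simps)
  ultimately have "((\<lambda>k. cos_excess k R r h) \<longlongrightarrow> R\<^sup>2 / 2 - h\<^sup>2 / 2 - 1 * (r\<^sup>2 / 2)) (at 0)"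
    by (rule Lim_transform_eventually)
  moreover have "R\<^sup>2 / 2 - h\<^sup>2 / 2 - 1 * (r\<^sup>2 / 2) = cos_excess 0 R r h"
    by (simp add: cos_excess_def field_simps)
  ultimately show ?thesis by simp
qed

text \<open>Apply cosh, strictly increasing on the nonnegative reals, to
  \<open>s * \<bar>h\<bar> \<le> arcosh q\<close>. The bound by \<open>R\<close> comes from
  \<open>q \<le> cosh (s * R)\<close>.\<close>

lemma le_alpha_curv_iff_neg:
  assumes "k < 0" "0 \<le> r" "r < R"
  shows "\<bar>h\<bar> \<le> alpha_curv k R r \<longleftrightarrow> \<bar>h\<bar> \<le> R \<and> 0 \<le> cos_excess k R r h"
proof -
  define s where "s = sqrt (- k)"
  define q where "q = cosh (s * R) / cosh (s * r)"
  have s: "0 < s" using assms by (simp add: s_def)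
  have "cosh (s * r) \<le> cosh (s * R)"
    using assms s by (simp add: cosh_real_nonneg_le_iff)
  then have q: "1 \<le> q" by (simp add: q_def)
  have "\<bar>h\<bar> \<le> alpha_curv k R r \<longleftrightarrow> s * \<bar>h\<bar> \<le> arcosh q"
    using assms s by (simp add: alpha_curv_def q_def field_simps flip: s_def)
  also have "\<dots> \<longleftrightarrow> cosh (s * \<bar>h\<bar>) \<le> cosh (arcosh q)"
    using s q by (intro cosh_real_nonneg_le_iff[symmetric]) (auto simp: arcosh_nonneg_real)
  also have "cosh (arcosh q) = q"
    using q by simp
  finally have iff: "\<bar>h\<bar> \<le> alpha_curv k R r \<longleftrightarrow> cosh (s * \<bar>h\<bar>) \<le> q" .
  \<comment> \<open>Division by the negative \<open>k\<close> reverses the inequality between the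
    cosh terms.\<close>
  have "0 \<le> cos_excess k R r h \<longleftrightarrow> cosh (s * h) \<le> q"
    using assms by (simp add: cos_excess_def cos_curv_def q_def divide_simps flip: s_def)
  also have "cosh (s * h) = cosh (s * \<bar>h\<bar>)"
    by (simp add: abs_if)
  finally have exc: "0 \<le> cos_excess k R r h \<longleftrightarrow> cosh (s * \<bar>h\<bar>) \<le> q" .
  have "q \<le> cosh (s * R)"
    using cosh_real_ge_1[of "s * r"] by (simp add: q_def divide_le_eq)
  moreover have "cosh (s * \<bar>h\<bar>) \<le> cosh (s * R) \<longleftrightarrow> \<bar>h\<bar> \<le> R"
    using assms s by (simp add: cosh_real_nonneg_le_iff)
  ultimately show ?thesis
    using iff exc by linarith
qed

text \<open>The bound on \<open>R\<close> puts \<open>q\<close> in \<open>[0, 1]\<close> and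
  \<open>arccos q\<close> in \<open>[0, pi / 2]\<close>. Cosine is decreasing only up to
  \<open>pi\<close>, so the direction from right to left relies on
  \<open>\<bar>h\<bar> \<le> R\<close>; by periodicity, the sign of \<open>cos_excess\<close> alone
  would admit far larger \<open>h\<close>.\<close>

lemma le_alpha_curv_iff_pos:
  assumes "0 < k" "0 \<le> r" "r < R" "ereal R \<le> max_radius k"
  shows "\<bar>h\<bar> \<le> alpha_curv k R r \<longleftrightarrow> \<bar>h\<bar> \<le> R \<and> 0 \<le> cos_excess k R r h"
proof -
  define s where "s = sqrt k"
  define q where "q = cos (s * R) / cos (s * r)"
  have s: "0 < s" using assms by (simp add: s_def)
  have sR: "s * R \<le> pi / 2"
    using assms by (simp add: le_max_radius_pos_iff s_def)
  moreover have "s * r < s * R" "0 \<le> s * r" using assms s by simp_all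
  ultimately have cr: "0 < cos (s * r)" and cR: "0 \<le> cos (s * R)"
    and crR: "cos (s * R) \<le> cos (s * r)"
    by (auto intro!: cos_gt_zero_pi cos_ge_zero cos_monotone_0_pi_le)
  then have q: "0 \<le> q" "q \<le> 1" by (auto simp: q_def)
  have ac: "0 \<le> arccos q" "arccos q \<le> pi / 2"
    using q arccos_lbound[of q] arccos_le_pi2[of q] by linarith+
  have qR: "cos (s * R) \<le> q"
    using cr cR mult_left_mono[of "cos (s * r)" 1 "cos (s * R)"] by (simp add: q_def le_divide_eq)
  have "\<bar>h\<bar> \<le> alpha_curv k R r \<longleftrightarrow> s * \<bar>h\<bar> \<le> arccos q"
    using assms s by (simp add: alpha_curv_def q_def field_simps flip: s_def)
  moreover have "s * \<bar>h\<bar> \<le> arccos q \<longleftrightarrow> q \<le> cos (s * \<bar>h\<bar>)" if "s * \<bar>h\<bar> \<le> pi"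
    using cos_mono_le_eq[of "arccos q" "s * \<bar>h\<bar>"] that s q ac pi_gt_zero by simp
  moreover have "\<bar>h\<bar> \<le> R" if le: "s * \<bar>h\<bar> \<le> arccos q"
  proof -
    have "cos (s * R) \<le> cos (s * \<bar>h\<bar>)"
      using calculation(2) le qR ac pi_gt_zero by linarith
    then have "s * \<bar>h\<bar> \<le> s * R"
      using cos_mono_le_eq[of "s * R" "s * \<bar>h\<bar>"] le ac s sR assms pi_gt_zero by simp
    then show ?thesis using s by simp
  qed
  moreover have "s * \<bar>h\<bar> \<le> pi" if "\<bar>h\<bar> \<le> R"
    using mult_left_mono[OF that, of s] s sR pi_gt_zero by linarith
  moreover have "0 \<le> cos_excess k R r h \<longleftrightarrow> q \<le> cos (s * \<bar>h\<bar>)"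
    using assms cos_curv_even[of k h] cr
    by (simp add: cos_excess_def cos_curv_def q_def field_simps flip: s_def)
  ultimately show ?thesis by blast
qed

lemma le_alpha_curv_iff:
  assumes "0 \<le> r" "r < R" "ereal R \<le> max_radius k"
  shows "\<bar>h\<bar> \<le> alpha_curv k R r \<longleftrightarrow> \<bar>h\<bar> \<le> R \<and> 0 \<le> cos_excess k R r h"
proof (cases k "0 :: real" rule: linorder_cases)
  case equal
  have "\<bar>h\<bar> \<le> sqrt (R\<^sup>2 - r\<^sup>2) \<longleftrightarrow> h\<^sup>2 \<le> R\<^sup>2 - r\<^sup>2"
    using real_sqrt_le_iff[of "h\<^sup>2" "R\<^sup>2 - r\<^sup>2"] by simp
  moreover have "\<bar>h\<bar> \<le> R" if "h\<^sup>2 \<le> R\<^sup>2 - r\<^sup>2"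
    using that assms abs_le_square_iff[of h R] by (simp add: algebra_simps) (smt (verit) zero_le_power2)
  ultimately show ?thesis
    using equal by (auto simp: alpha_curv_def cos_excess_def algebra_simps)
qed (use assms le_alpha_curv_iff_neg le_alpha_curv_iff_pos in auto)

text \<open>At \<open>r = 0\<close> the denominator is 1 and the inverse function cancels; for
  \<open>k > 0\<close> the bound on \<open>R\<close> keeps \<open>sqrt k * R\<close> in the range of
  arccos.\<close>

lemma alpha_curv_0:
  assumes "0 < R" "ereal R \<le> max_radius k"
  shows "alpha_curv k R 0 = R"
proof (cases k "0 :: real" rule: linorder_cases)
  case greater
  then have "sqrt k * R \<le> pi / 2"
    using assms by (simp add: le_max_radius_pos_iff)
  then have "sqrt k * R \<le> pi"
    using pi_gt_zero by linarith
  then have "arccos (cos (sqrt k * R)) = sqrt k * R"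
    using assms greater by (intro arccos_cos) auto
  with greater show ?thesis by (simp add: alpha_curv_def)
qed (use assms in \<open>simp_all add: alpha_curv_def arcosh_cosh_real\<close>)

section \<open>Sign and curvature-independent bound of the generalised cosine\<close>

lemma cos_curv_nonneg:
  assumes "\<bar>h\<bar> \<le> R" "ereal R \<le> max_radius k"
  shows "0 \<le> cos_curv k h"
proof (cases "k > 0")
  case True
  have "sqrt k * \<bar>h\<bar> \<le> sqrt k * R"
    using assms True by (intro mult_left_mono) auto
  also have "\<dots> \<le> pi / 2"
    using assms True by (simp add: le_max_radius_pos_iff)
  finally have "0 \<le> cos (sqrt k * \<bar>h\<bar>)"
    using True by (intro cos_ge_zero) (auto intro: order.trans[of _ 0])
  then show ?thesis
    using True cos_curv_even[of k h] by (simp add: cos_curv_def)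
qed (auto simp: cos_curv_def)

text \<open>For \<open>k \<ge> 0\<close> the value 1 separates cosine from cosh; for
  \<open>k < 0\<close> cosh is monotone in \<open>sqrt (- k) * \<bar>h\<bar>\<close>.\<close>

lemma cos_curv_le:
  assumes "\<bar>k\<bar> \<le> c"
  shows "cos_curv k h \<le> cos_curv (- c) h"
proof -
  have 1: "1 \<le> cos_curv (- c) h"
    using assms by (auto simp: cos_curv_def cosh_real_ge_1)
  show ?thesis
  proof (cases "k < 0")
    case True
    have "cosh (sqrt (- k) * \<bar>h\<bar>) \<le> cosh (sqrt c * \<bar>h\<bar>)"
      using assms True by (subst cosh_real_nonneg_le_iff) (auto intro!: mult_right_mono)
    then show ?thesis
      using assms True cos_curv_even[of k h] cos_curv_even[of "- c" h]
      by (simp add: cos_curv_def)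
  next
    case False
    then have "cos_curv k h \<le> 1" by (simp add: cos_curv_def)
    with 1 show ?thesis by linarith
  qed
qed

section \<open>Convergence of the tail integrals\<close>

text \<open>This is the numerator of the tail formula in
  \<open>is_section_radius_distribution\<close>. At \<open>r = 0\<close> it becomes the denominator,
  so one limit theorem serves both.\<close>

definition section_tail :: "nat \<Rightarrow> real measure \<Rightarrow> real \<Rightarrow> real \<Rightarrow> ennreal" where
  "section_tail d \<nu> k r =
     (\<integral>\<^sup>+R\<in>Ioc_ereal r (max_radius k).
        (\<integral>\<^sup>+h\<in>{- alpha_curv k R r..alpha_curv k R r}.
           ennreal (cos_curv k h ^ (d - 1)) \<partial>lborel) \<partial>\<nu>)"

lemma section_tail_0: "section_tail d \<nu> k 0 = intensity_ratio d \<nu> k"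
  unfolding section_tail_def intensity_ratio_def
  by (intro nn_integral_cong) (auto simp: Ioc_ereal_def alpha_curv_0 indicator_def)

text \<open>All cutoffs sit inside the integrand, so that the domains of both integrals are
  independent of \<open>k\<close>. The cutoff uses \<open>cos_excess\<close> instead of
  \<open>alpha_curv\<close> because its limit and measurability are direct.\<close>

definition section_integrand :: "nat \<Rightarrow> real \<Rightarrow> real \<Rightarrow> real \<Rightarrow> real \<Rightarrow> ennreal" where
  "section_integrand d k r R h =
     (if r < R \<and> ereal R \<le> max_radius k \<and> \<bar>h\<bar> \<le> R \<and> 0 \<le> cos_excess k R r h
      then ennreal (cos_curv k h ^ (d - 1)) else 0)"

lemma section_tail_eq:
  assumes "0 \<le> r"
  shows "section_tail d \<nu> k r = (\<integral>\<^sup>+R. \<integral>\<^sup>+h. section_integrand d k r R h \<partial>lborel \<partial>\<nu>)"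
  unfolding section_tail_def
proof (rule nn_integral_cong)
  fix R
  show "(\<integral>\<^sup>+h\<in>{- alpha_curv k R r..alpha_curv k R r}.
            ennreal (cos_curv k h ^ (d - 1)) \<partial>lborel) * indicator (Ioc_ereal r (max_radius k)) R
        = (\<integral>\<^sup>+h. section_integrand d k r R h \<partial>lborel)"
  proof (cases "r < R \<and> ereal R \<le> max_radius k")
    case True
    have "h \<in> {- alpha_curv k R r..alpha_curv k R r} \<longleftrightarrow> \<bar>h\<bar> \<le> R \<and> 0 \<le> cos_excess k R r h" for h
      using le_alpha_curv_iff[of r R k h] assms True by auto
    with True show ?thesis
      by (auto simp: Ioc_ereal_def section_integrand_def indicator_def intro!: nn_integral_cong)
  next
    case False
    then have "section_integrand d k r R h = 0" for h
      by (auto simp: section_integrand_def)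
    with False show ?thesis by (auto simp: Ioc_ereal_def)
  qed
qed

section \<open>Joint measurability and domination of the integrand\<close>

lemma borel_measurable_cos_curv [measurable]: "cos_curv k \<in> borel_measurable borel"
proof (rule borel_measurable_continuous_onI)
  show "continuous_on UNIV (cos_curv k)"
    unfolding cos_curv_def by (cases k "0 :: real" rule: linorder_cases) (auto intro!: continuous_intros)
qed

lemma measurable_section_integrand [measurable]:
  "case_prod (section_integrand d k r) \<in> borel_measurable (borel \<Otimes>\<^sub>M borel)"
  unfolding section_integrand_def cos_excess_def by measurable

text \<open>At curvature \<open>- c\<close> and \<open>r = 0\<close> the half-width
  \<open>alpha_curv\<close> equals \<open>R\<close> and \<open>max_radius\<close> is infinite, so
  the domain grows; the factor grows by \<open>cos_curv_le\<close>.\<close>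

lemma section_integrand_le:
  assumes "\<bar>k\<bar> \<le> c" "0 \<le> r"
  shows "section_integrand d k r R h \<le> section_integrand d (- c) 0 R h"
proof (cases "r < R \<and> ereal R \<le> max_radius k \<and> \<bar>h\<bar> \<le> R")
  case True
  then have "0 \<le> cos_excess (- c) R 0 h"
    using assms le_alpha_curv_iff[of 0 R "- c" h] by (simp add: max_radius_nonpos alpha_curv_0)
  moreover have "cos_curv k h ^ (d - 1) \<le> cos_curv (- c) h ^ (d - 1)"
    using True assms by (intro power_mono cos_curv_le cos_curv_nonneg) auto
  ultimately show ?thesis
    using True assms by (auto simp: section_integrand_def max_radius_nonpos intro!: ennreal_leI)
qed (auto simp: section_integrand_def)

text \<open>The integrand is at most its value at \<open>h = R\<close>, on a bounded interval. This
  licenses dominated convergence in \<open>h\<close> for each fixed \<open>R\<close>.\<close>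

lemma nn_integral_section_integrand_finite:
  assumes "0 \<le> c"
  shows "(\<integral>\<^sup>+h. section_integrand d (- c) 0 R h \<partial>lborel) < \<infinity>"
proof -
  have "section_integrand d (- c) 0 R h
          \<le> ennreal (cos_curv (- c) R ^ (d - 1)) * indicator {- R..R} h" for h
  proof (cases "\<bar>h\<bar> \<le> R")
    case True
    have "cosh (sqrt c * \<bar>h\<bar>) \<le> cosh (sqrt c * R)"
      using assms True by (subst cosh_real_nonneg_le_iff) (auto intro!: mult_left_mono)
    then have "cos_curv (- c) h \<le> cos_curv (- c) R"
      using assms cos_curv_even[of "- c" h] by (simp add: cos_curv_def split: if_splits)
    moreover have "0 \<le> cos_curv (- c) h"
      using True assms by (intro cos_curv_nonneg[of _ R]) (auto simp: max_radius_nonpos)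
    ultimately show ?thesis
      using True by (auto simp: section_integrand_def indicator_def intro!: ennreal_leI power_mono)
  qed (auto simp: section_integrand_def)
  then have "(\<integral>\<^sup>+h. section_integrand d (- c) 0 R h \<partial>lborel)
      \<le> (\<integral>\<^sup>+h. ennreal (cos_curv (- c) R ^ (d - 1)) * indicator {- R..R} h \<partial>lborel)"
    by (intro nn_integral_mono) auto
  also have "\<dots> < \<infinity>"
    by (simp add: nn_integral_cmult_indicator ennreal_mult_less_top emeasure_lborel_Icc_eq)
  finally show ?thesis .
qed

section \<open>Pointwise limit of the integrand and of the tail integrals\<close>

lemma eventually_less_max_radius: "\<forall>\<^sub>F k in at 0. ereal x < max_radius k"
proof -
  \<comment> \<open>The absolute value under the root treats both signs of \<open>k\<close> at
    once.\<close>
  have "((\<lambda>k. sqrt \<bar>k\<bar> * x) \<longlongrightarrow> sqrt \<bar>0\<bar> * x) (at 0)"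
    by (intro tendsto_intros)
  then have "\<forall>\<^sub>F k in at 0. sqrt \<bar>k\<bar> * x < pi / 2"
    by (rule order_tendstoD) simp
  then show ?thesis
    by eventually_elim (auto simp: max_radius_def field_simps)
qed

text \<open>Off the boundary of the limiting domain the sign of \<open>cos_excess\<close> is
  eventually constant, and \<open>R\<close> is eventually below \<open>max_radius k\<close>. The
  cutoff is then frozen and only the cosine factor moves, with limit 1.\<close>

lemma section_integrand_tendsto:
  assumes "cos_excess 0 R r h \<noteq> 0"
  shows "((\<lambda>k. section_integrand d k r R h) \<longlongrightarrow> section_integrand d 0 r R h) (at 0)"
proof -
  have "\<forall>\<^sub>F k in at 0. 0 \<le> cos_excess k R r h \<longleftrightarrow> 0 \<le> cos_excess 0 R r h"
  proof (cases "0 < cos_excess 0 R r h")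
    case True
    then show ?thesis
      using order_tendstoD(1)[OF cos_excess_tendsto True] by (auto elim!: eventually_mono)
  next
    case False
    with assms have "cos_excess 0 R r h < 0" by simp
    from order_tendstoD(2)[OF cos_excess_tendsto this] this show ?thesis
      by (auto elim!: eventually_mono)
  qed
  with eventually_less_max_radius[of R]
  have "\<forall>\<^sub>F k in at 0.
      (if r < R \<and> \<bar>h\<bar> \<le> R \<and> 0 \<le> cos_excess 0 R r h then ennreal (cos_curv k h ^ (d - 1)) else 0)
      = section_integrand d k r R h"
    by eventually_elim (auto simp: section_integrand_def)
  moreover have "((\<lambda>k. if r < R \<and> \<bar>h\<bar> \<le> R \<and> 0 \<le> cos_excess 0 R r h
      then ennreal (cos_curv k h ^ (d - 1)) else 0) \<longlongrightarrow> section_integrand d 0 r R h) (at 0)"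
  proof -
    have "((\<lambda>k. ennreal (cos_curv k h ^ (d - 1))) \<longlongrightarrow> ennreal (1 ^ (d - 1))) (at 0)"
      by (intro tendsto_intros cos_curv_tendsto)
    then show ?thesis
      by (cases "r < R \<and> \<bar>h\<bar> \<le> R \<and> 0 \<le> cos_excess 0 R r h")
         (auto simp: section_integrand_def max_radius_nonpos cos_curv_def[of 0])
  qed
  ultimately show ?thesis
    by (rule Lim_transform_eventually[rotated])
qed

text \<open>The zeros lie among the two points \<open>sqrt (R\<^sup>2 - r\<^sup>2)\<close> and its
  negative.\<close>

lemma AE_cos_excess_nonzero: "AE h in lborel. cos_excess 0 R r h \<noteq> 0"
proof -
  have "AE h in lborel. h \<noteq> sqrt (R\<^sup>2 - r\<^sup>2)" "AE h in lborel. h \<noteq> - sqrt (R\<^sup>2 - r\<^sup>2)"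
    by (rule AE_lborel_singleton)+
  then show ?thesis
  proof eventually_elim
    case (elim h)
    show ?case
    proof
      assume "cos_excess 0 R r h = 0"
      then have "R\<^sup>2 - r\<^sup>2 = h\<^sup>2" by (simp add: cos_excess_def)
      with elim show False by (auto simp: abs_if split: if_splits)
    qed
  qed
qed

text \<open>Dominated convergence is applied twice: in \<open>h\<close> for fixed \<open>R\<close>,
  then in \<open>R\<close> with respect to \<nu>. Both majorants come from the integrand at
  \<open>- c\<close> and radius 0.\<close>

lemma section_tail_tendsto:
  assumes "sets \<nu> = sets borel" "0 < c" "0 \<le> r" "intensity_ratio d \<nu> (- c) < \<infinity>"
    and X: "X \<longlonglongrightarrow> 0" "\<And>n. X n \<noteq> 0" "\<And>n. \<bar>X n\<bar> \<le> c"
  shows "(\<lambda>n. section_tail d \<nu> (X n) r) \<longlonglongrightarrow> section_tail d \<nu> 0 r"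
proof -
  have [measurable_cong]: "sets \<nu> = sets borel" by fact
  have X0: "filterlim X (at 0) sequentially"
    using X by (simp add: filterlim_at)
  have inner: "(\<lambda>n. \<integral>\<^sup>+h. section_integrand d (X n) r R h \<partial>lborel)
      \<longlonglongrightarrow> (\<integral>\<^sup>+h. section_integrand d 0 r R h \<partial>lborel)" for R
  proof (rule nn_integral_dominated_convergence)
    show "AE h in lborel. section_integrand d (X n) r R h \<le> section_integrand d (- c) 0 R h" for n
      using X assms by (simp add: section_integrand_le)
    show "(\<integral>\<^sup>+h. section_integrand d (- c) 0 R h \<partial>lborel) < \<infinity>"
      using assms by (intro nn_integral_section_integrand_finite) simp
    show "AE h in lborel. (\<lambda>n. section_integrand d (X n) r R h) \<longlonglongrightarrow> section_integrand d 0 r R h"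
      using AE_cos_excess_nonzero[of R r]
      by eventually_elim (rule filterlim_compose[OF section_integrand_tendsto X0])
  qed measurable
  have "(\<lambda>n. \<integral>\<^sup>+R. \<integral>\<^sup>+h. section_integrand d (X n) r R h \<partial>lborel \<partial>\<nu>)
      \<longlonglongrightarrow> (\<integral>\<^sup>+R. \<integral>\<^sup>+h. section_integrand d 0 r R h \<partial>lborel \<partial>\<nu>)"
  proof (rule nn_integral_dominated_convergence)
    show "AE R in \<nu>. (\<integral>\<^sup>+h. section_integrand d (X n) r R h \<partial>lborel)
        \<le> (\<integral>\<^sup>+h. section_integrand d (- c) 0 R h \<partial>lborel)" for n
      using X assms by (intro AE_I2 nn_integral_mono section_integrand_le) auto
    \<comment> \<open>This double integral is the intensity ratio at \<open>- c\<close>.\<close>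
    show "(\<integral>\<^sup>+R. \<integral>\<^sup>+h. section_integrand d (- c) 0 R h \<partial>lborel \<partial>\<nu>) < \<infinity>"
      using assms section_tail_eq[of 0 d \<nu> "- c"] by (simp add: section_tail_0)
    show "AE R in \<nu>. (\<lambda>n. \<integral>\<^sup>+h. section_integrand d (X n) r R h \<partial>lborel)
        \<longlonglongrightarrow> (\<integral>\<^sup>+h. section_integrand d 0 r R h \<partial>lborel)"
      using inner by simp
  qed measurable
  then show ?thesis
    using assms by (simp add: section_tail_eq)
qed

section \<open>Weak convergence\<close>

text \<open>Inversion is continuous on all of \<open>ennreal\<close>; positivity of \<open>b\<close>
  and finiteness of \<open>a\<close> exclude the product of 0 and infinity.\<close>

lemma tendsto_divide_ennreal:
  fixes f g :: "'a \<Rightarrow> ennreal"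
  assumes f: "(f \<longlongrightarrow> a) F" and g: "(g \<longlongrightarrow> b) F" and b: "0 < b" and a: "a < top"
  shows "((\<lambda>x. f x / g x) \<longlongrightarrow> a / b) F"
proof -
  have "continuous_on UNIV (inverse :: ennreal \<Rightarrow> ennreal)"
    by (intro continuous_on_inverse_ennreal continuous_on_id)
  then have "((\<lambda>x. inverse (g x)) \<longlongrightarrow> inverse b) F"
    using g by (rule continuous_on_tendsto_compose) auto
  with f show ?thesis
    unfolding divide_ennreal_def using a b by (intro tendsto_mult_ennreal) auto
qed

section \<open>Distribution functions of the section radii\<close>

lemma emeasure_section_radius_distribution:
  assumes "is_section_radius_distribution d \<nu> k N" "0 \<le> r" "ereal r < max_radius k"
  shows "emeasure N (Ioc_ereal r (max_radius k)) = section_tail d \<nu> k r / intensity_ratio d \<nu> k"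
  using assms unfolding is_section_radius_distribution_def section_tail_def by blast

lemma cdf_section_radius_distribution:
  assumes "is_section_radius_distribution d \<nu> k N" "0 \<le> r" "ereal r < max_radius k"
  shows "cdf N r = 1 - enn2real (section_tail d \<nu> k r / intensity_ratio d \<nu> k)"
proof -
  interpret real_distribution N
    using assms(1) by (simp add: is_section_radius_distribution_def radius_distribution_def)
  have meas: "Ioc_ereal r' l \<in> sets N" for r' l
    by (simp add: Ioc_ereal_def)
  have "prob (Ioc_ereal 0 (max_radius k)) = 1"
    using assms(1) by (simp add: is_section_radius_distribution_def measure_def)
  then have AE: "AE x in N. x \<in> Ioc_ereal 0 (max_radius k)"
    using meas by (simp add: prob_eq_1)
  have "cdf N r = prob {..r}" by (simp add: cdf_def)
  \<comment> \<open>The complement also contains the points above \<open>max_radius k\<close>, which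
    form a null set.\<close>
  also have "\<dots> = prob (space N - Ioc_ereal r (max_radius k))"
    using AE assms(2) meas by (intro finite_measure_eq_AE) (auto simp: Ioc_ereal_def)
  also have "\<dots> = 1 - prob (Ioc_ereal r (max_radius k))"
    using meas by (rule prob_compl)
  finally show ?thesis
    by (simp add: measure_def emeasure_section_radius_distribution[OF assms])
qed

lemma cdf_radius_distribution_nonpos:
  assumes "radius_distribution N" "r \<le> 0"
  shows "cdf N r = 0"
proof -
  interpret real_distribution N
    using assms(1) by (simp add: radius_distribution_def)
  have "prob {0<..} = 1"
    using assms(1) by (simp add: radius_distribution_def measure_def)
  then have "AE x in N. x \<in> {0<..}"
    by (simp add: prob_eq_1)
  then have "prob {..r} = prob {}"
    using assms(2) by (intro finite_measure_eq_AE) auto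
  then show ?thesis by (simp add: cdf_def)
qed

text \<open>An infinite numerator over a finite denominator would give an infinite
  probability.\<close>

lemma section_tail_finite:
  assumes "is_section_radius_distribution d \<nu> k N" "0 \<le> r" "ereal r < max_radius k"
    and "0 < intensity_ratio d \<nu> k" "intensity_ratio d \<nu> k < \<infinity>"
  shows "section_tail d \<nu> k r < \<infinity>"
proof (rule ccontr)
  interpret real_distribution N
    using assms(1) by (simp add: is_section_radius_distribution_def radius_distribution_def)
  assume "\<not> section_tail d \<nu> k r < \<infinity>"
  then have "section_tail d \<nu> k r / intensity_ratio d \<nu> k = \<infinity>"
    using assms by (auto simp: ennreal_divide_eq_top_iff less_top)
  then show False
    using emeasure_section_radius_distribution[OF assms(1-3)] emeasure_finite by simp
qed

theorem theorem6p1: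
  fixes d :: nat and \<nu> :: "real measure" and \<kappa> :: real and \<nu>' :: "real \<Rightarrow> real measure"
  assumes "d \<ge> 2"
    and "radius_distribution \<nu>"
    and "\<kappa> > 0"
    and "\<And>k. - \<kappa> < k \<Longrightarrow> k < \<kappa> \<Longrightarrow> 0 < intensity_ratio d \<nu> k \<and> intensity_ratio d \<nu> k < \<infinity>"
    and "\<And>k. - \<kappa> < k \<Longrightarrow> k < \<kappa> \<Longrightarrow> is_section_radius_distribution d \<nu> k (\<nu>' k)"
  shows "weak_conv_along (at 0) \<nu>' (\<nu>' 0)"
proof -
  \<comment> \<open>Halving puts \<open>- c\<close> strictly inside the interval of finite intensity
    ratios, which makes the majorant integrable.\<close>
  define c where "c = \<kappa> / 2"
  have c: "0 < c" "c < \<kappa>" using assms(3) by (auto simp: c_def)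
  have sets: "sets \<nu> = sets borel"
    using assms(2) by (simp add: radius_distribution_def real_distribution_def real_distribution_axioms_def)
  \<comment> \<open>Dominated convergence and the criterion by distribution functions work along
    sequences, so the limit is first taken along arbitrary ones avoiding 0.\<close>
  have "weak_conv_along sequentially (\<nu>' \<circ> X) (\<nu>' 0)"
    if X: "X \<longlonglongrightarrow> 0" "\<And>n. X n \<noteq> 0" "\<And>n. \<bar>X n\<bar> < c" for X
  proof -
    have sec: "is_section_radius_distribution d \<nu> (X n) (\<nu>' (X n))"
        "is_section_radius_distribution d \<nu> 0 (\<nu>' 0)" for n
      using assms(5) X(3)[of n] c by (auto simp: abs_less_iff)
    have ratio: "0 < intensity_ratio d \<nu> 0" "intensity_ratio d \<nu> 0 < \<infinity>"
        "intensity_ratio d \<nu> (- c) < \<infinity>"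
      using assms(4)[of 0] assms(4)[of "- c"] c by auto
    \<comment> \<open>Convergence is shown at every \<open>r\<close>, hence in particular at the
      continuity points of the limit.\<close>
    have "(\<lambda>n. cdf (\<nu>' (X n)) r) \<longlonglongrightarrow> cdf (\<nu>' 0) r" for r
    proof (cases "r \<le> 0")
      case True
      have "cdf (\<nu>' (X n)) r = 0" "cdf (\<nu>' 0) r = 0" for n
        using sec True
        by (auto simp: is_section_radius_distribution_def intro: cdf_radius_distribution_nonpos)
      then show ?thesis by simp
    next
      case False
      then have r: "0 \<le> r" "ereal r < max_radius 0" by (auto simp: max_radius_nonpos)
      let ?p = "\<lambda>k. section_tail d \<nu> k r / intensity_ratio d \<nu> k"
      have tail: "(\<lambda>n. section_tail d \<nu> (X n) s) \<longlonglongrightarrow> section_tail d \<nu> 0 s" if "0 \<le> s" for s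
        using X that c ratio by (intro section_tail_tendsto[OF sets]) (auto intro: less_imp_le)
      have "section_tail d \<nu> 0 r < top"
        using section_tail_finite[OF sec(2) r ratio(1,2)] by simp
      then have p: "(\<lambda>n. ?p (X n)) \<longlonglongrightarrow> ?p 0"
        using tail[OF r(1)] tail[of 0] ratio
        by (intro tendsto_divide_ennreal) (auto simp: section_tail_0)
      \<comment> \<open>\<open>enn2real\<close> sends \<open>top\<close> to 0, so passing to real
        numbers in the limit needs a finite value.\<close>
      have "?p 0 < top"
        using \<open>section_tail d \<nu> 0 r < top\<close> ratio
        by (metis ennreal_divide_eq_top_iff less_top not_gr_zero)
      then have "(\<lambda>n. 1 - enn2real (?p (X n))) \<longlonglongrightarrow> 1 - enn2real (?p 0)"
        using p by (intro tendsto_intros) auto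
      \<comment> \<open>The tail formula at \<open>r\<close> applies only below
        \<open>max_radius (X n)\<close>, which holds for large \<open>n\<close>.\<close>
      moreover have "\<forall>\<^sub>F n in sequentially. ereal r < max_radius (X n)"
      proof -
        have "filterlim X (at 0) sequentially"
          using X by (simp add: filterlim_at)
        then show ?thesis
          using eventually_less_max_radius by (rule eventually_compose_filterlim[rotated])
      qed
      then have "\<forall>\<^sub>F n in sequentially. 1 - enn2real (?p (X n)) = cdf (\<nu>' (X n)) r"
        by eventually_elim (simp add: cdf_section_radius_distribution[OF sec(1) r(1)])
      ultimately have "(\<lambda>n. cdf (\<nu>' (X n)) r) \<longlonglongrightarrow> 1 - enn2real (?p 0)"
        by (rule Lim_transform_eventually)
      then show ?thesis
        by (simp add: cdf_section_radius_distribution[OF sec(2) r])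
    qed
    then have "weak_conv_m (\<nu>' \<circ> X) (\<nu>' 0)"
      by (simp add: weak_conv_m_def weak_conv_def)
    moreover have "real_distribution ((\<nu>' \<circ> X) n)" "real_distribution (\<nu>' 0)" for n
      using sec by (auto simp: is_section_radius_distribution_def radius_distribution_def)
    ultimately show ?thesis
      by (simp add: weak_conv_along_sequentially_iff)
  qed
  then have *: "(\<lambda>n. integral\<^sup>L (\<nu>' (X n)) f) \<longlonglongrightarrow> integral\<^sup>L (\<nu>' 0) f"
    if "X \<longlonglongrightarrow> 0" "\<And>n. X n \<noteq> 0" "\<And>n. \<bar>X n\<bar> < c" "continuous_on UNIV f" "bounded (range f)"
    for X and f :: "real \<Rightarrow> real"
    using that by (simp add: weak_conv_along_def)
  \<comment> \<open>Restriction to the open interval supplies the bound by \<open>c\<close> on the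
    test sequences without changing the filter at 0.\<close>
  have "((\<lambda>k. integral\<^sup>L (\<nu>' k) f) \<longlongrightarrow> integral\<^sup>L (\<nu>' 0) f) (at 0 within {- c<..<c})"
    if "continuous_on UNIV f" "bounded (range f)" for f :: "real \<Rightarrow> real"
    unfolding tendsto_at_iff_sequentially comp_def
    using that by (intro allI impI *) (auto simp: abs_less_iff minus_less_iff)
  moreover have "at 0 within {- c<..<c} = at (0 :: real)"
    using c by (intro at_within_open) auto
  ultimately show ?thesis
    by (simp add: weak_conv_along_def)
qed

end
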